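(* If $N\ge k+1$, then the relative worst order ratio of FIFO to LRU on the path access graph $P_N$ is defined and equals $$\mathrm{WR}^{P_N}_{\mathrm{FIFO},\mathrm{LRU}}=\frac{k+1}{2}.$$
   Context: Paging: a cache of size $k\ge1$, initially empty; on a request to a page not in cache (a fault) the page is brought in, evicting a page if the cache is full; $\mathrm{A}(I)$ is the number of faults of algorithm $\mathrm{A}$ on $I$. LRU evicts the least recently requested page in cache; FIFO evicts the page that has been in cache the longest. An access graph is an undirected graph whose vertices are the pages; a sequence respects it if any two consecutive requests are to the same page or to adjacent vertices. $P_N$ is the path graph on $N$ vertices. For an algorithm $\mathrm{A}$ and access graph $G$, $\mathrm{A}^G_W(I)=\max_\sigma \mathrm{A}(\sigma(I))$ over all permutations $\sigma$ of the requests of $I$ such that $\sigma(I)$ respects $G$. Relative worst order ratio on $G$: $c_l(\mathrm{A},\mathrm{B})=\sup\{c\mid \exists b\ \forall I \text{ respecting } G:\ \mathrm{A}^G_W(I)\ge c\,\mathrm{B}^G_W(I)-b\}$ and $c_u(\mathrm{A},\mathrm{B})=\inf\{c\mid \exists b\ \forall I \text{ respecting } G:\ \mathrm{A}^G_W(I)\le c\,\mathrm{B}^G_W(I)+b\}$. If $c_l\ge1$ or $c_u\le1$ the algorithms are comparable and $\mathrm{WR}^G_{\mathrm{A},\mathrm{B}}$ is defined as $c_u(\mathrm{A},\mathrm{B})$ if $c_l(\mathrm{A},\mathrm{B})\ge1$, and as $c_l(\mathrm{A},\mathrm{B})$ if $c_u(\mathrm{A},\mathrm{B})\le1$; otherwise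 it is undefined. *)

theory Defs
  imports Complex_Main "HOL-Library.Multiset" "HOL-Library.Extended_Real"
begin

(* The state of a paging algorithm is its cache, as a list without repetitions whose order is the
   algorithm's eviction order: the last page is evicted next. Under FIFO the list is sorted by
   time of entry into the cache, under LRU by time of the last request, newest first. *)

definition bring_in :: "nat \<Rightarrow> 'a list \<Rightarrow> 'a \<Rightarrow> 'a list" where
  "bring_in k C p = (if length C < k then p # C else p # butlast C)"

definition fifo_step :: "nat \<Rightarrow> 'a list \<Rightarrow> 'a \<Rightarrow> 'a list" where
  "fifo_step k C p = (if p \<in> set C then C else bring_in k C p)"

definition lru_step :: "nat \<Rightarrow> 'a list \<Rightarrow> 'a \<Rightarrow> 'a list" where
  "lru_step k C p = (if p \<in> set C then p # remove1 p C else bring_in k C p)"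

fun faults_from :: "('a list \<Rightarrow> 'a \<Rightarrow> 'a list) \<Rightarrow> 'a list \<Rightarrow> 'a list \<Rightarrow> nat" where
  "faults_from step C [] = 0"
| "faults_from step C (p # I) = (if p \<in> set C then 0 else 1) + faults_from step (step C p) I"

definition FIFO :: "nat \<Rightarrow> 'a list \<Rightarrow> nat" where
  "FIFO k I = faults_from (fifo_step k) [] I"

definition LRU :: "nat \<Rightarrow> 'a list \<Rightarrow> nat" where
  "LRU k I = faults_from (lru_step k) [] I"

(* vertices and undirected edges *)
type_synonym 'a graph = "'a set \<times> 'a set set"

definition path_graph :: "nat \<Rightarrow> nat graph" where
  "path_graph N = ({..<N}, {{i, Suc i} | i. Suc i < N})"

definition respects_graph :: "'a graph \<Rightarrow> 'a list \<Rightarrow> bool" where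
  "respects_graph G I \<longleftrightarrow> set I \<subseteq> fst G \<and> successively (\<lambda>p q. p = q \<or> {p, q} \<in> snd G) I"

(* In the following, an algorithm enters only through its cost function. The maximum is over a
   finite set, which is nonempty whenever I itself respects G. *)
definition worst_order :: "'a graph \<Rightarrow> ('a list \<Rightarrow> nat) \<Rightarrow> 'a list \<Rightarrow> nat" where
  "worst_order G A I = Max {A J | J. mset J = mset I \<and> respects_graph G J}"

definition c_l :: "'a graph \<Rightarrow> ('a list \<Rightarrow> nat) \<Rightarrow> ('a list \<Rightarrow> nat) \<Rightarrow> ereal" where
  "c_l G A B = Sup {ereal c | c. \<exists>b::real. \<forall>I. respects_graph G I \<longrightarrow>
     real (worst_order G A I) \<ge> c * real (worst_order G B I) - b}"

definition c_u :: "'a graph \<Rightarrow> ('a list \<Rightarrow> nat) \<Rightarrow> ('a list \<Rightarrow> nat) \<Rightarrow> ereal" where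
  "c_u G A B = Inf {ereal c | c. \<exists>b::real. \<forall>I. respects_graph G I \<longrightarrow>
     real (worst_order G A I) \<le> c * real (worst_order G B I) + b}"

(* None means undefined (incomparable algorithms). The two cases can only disagree if the
   worst-order cost of B is bounded on G: otherwise c_l <= c_u, so in the overlap both equal 1. *)
definition WR :: "'a graph \<Rightarrow> ('a list \<Rightarrow> nat) \<Rightarrow> ('a list \<Rightarrow> nat) \<Rightarrow> ereal option" where
  "WR G A B =
     (if c_l G A B \<ge> 1 then Some (c_u G A B)
      else if c_u G A B \<le> 1 then Some (c_l G A B)
      else None)"

end

(*
  LRU dominates FIFO on every walk: the LRU cache is an interval around the current page, so LRU
  evicts the page that will be reached last.

  Upper bound. Cut a walk into phases of k + 1 FIFO faults. FIFO faults that are at most k apart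
  concern different pages. If a phase starts and ends with a fault on the same page, it crosses
  each edge of some k consecutive ones twice; otherwise it has k + 2 different fault pages and
  crosses each of some k + 1 consecutive edges once. Up to a bounded loss the requests can be
  rearranged into round trips, on k edges for each phase of the first kind, on k + 1 edges for
  every two of the second. On these LRU faults at least 2 and 4 times, respectively, hence twice
  per phase. The rearrangement is essential: on a long path (k = 4, N = 9) FIFO can have more than
  (k + 1)/2 times the faults of LRU on the same sequence.

  Lower bound. Zigzag on k + 1 vertices. FIFO faults on all k + 1 pages in each round trip, while
  LRU, in any order of the requests, faults only at the two ends once its cache is full.
*)

theory Submission
  imports Defs
begin

section \<open>Walks on the path and worst orders\<close>

definition adj :: "nat \<Rightarrow> nat \<Rightarrow> bool" where
  "adj p q \<longleftrightarrow> q = p \<or> q = Suc p \<or> p = Suc q"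

lemma respects_path_graph_iff:
  "respects_graph (path_graph N) I \<longleftrightarrow> set I \<subseteq> {..<N} \<and> successively adj I"
proof -
  have "successively (\<lambda>p q. p = q \<or> {p, q} \<in> snd (path_graph N)) I \<longleftrightarrow> successively adj I"
    if "set I \<subseteq> {..<N}"
    using that by (intro successively_cong) (auto simp: adj_def path_graph_def doubleton_eq_iff)
  then show ?thesis
    by (auto simp: respects_graph_def path_graph_def)
qed

lemma finite_same_mset: "finite {J. mset J = M}"
proof (cases "\<exists>I. mset I = M")
  case True
  then obtain I where "mset I = M" by blast
  then have "{J. mset J = M} \<subseteq> {J. set J \<subseteq> set I \<and> length J = length I}"
    by (auto dest: mset_eq_setD mset_eq_length)
  then show ?thesis
    by (rule finite_subset) (simp add: finite_lists_length_eq)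
qed simp

lemma worst_order_ge:
  assumes "mset J = mset I" "respects_graph G J"
  shows "A J \<le> worst_order G A I"
  unfolding worst_order_def using assms
  by (intro Max_ge) (auto intro: finite_subset[OF _ finite_imageI[OF finite_same_mset[of "mset I"]], of _ A])

lemma worst_order_attained:
  assumes "respects_graph G I"
  obtains J where "mset J = mset I" "respects_graph G J" "worst_order G A I = A J"
proof -
  let ?S = "{A J | J. mset J = mset I \<and> respects_graph G J}"
  have "finite ?S"
    by (auto intro: finite_subset[OF _ finite_imageI[OF finite_same_mset[of "mset I"]], of _ A])
  moreover have "?S \<noteq> {}"
    using assms by auto
  ultimately have "Max ?S \<in> ?S"
    by (rule Max_in)
  then show thesis
    using that unfolding worst_order_def by blast
qed

section \<open>Fault counts of demand paging\<close>

lemma faults_from_append: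
  "faults_from step C (xs @ ys) = faults_from step C xs + faults_from step (foldl step C xs) ys"
  by (induction xs arbitrary: C) auto

text \<open>Only what FIFO and LRU share: bounded size, the requested page is cached, no other page
  enters. The eviction order is left open, so LRU can be compared with any such algorithm.\<close>

locale demand_paging =
  fixes k :: nat and step :: "'a list \<Rightarrow> 'a \<Rightarrow> 'a list"
  assumes length_step: "length C \<le> k \<Longrightarrow> length (step C p) \<le> k"
    and mem_step: "p \<in> set (step C p)"
    and step_subset: "set (step C p) \<subseteq> insert p (set C)"
begin

lemma length_foldl: "length C \<le> k \<Longrightarrow> length (foldl step C w) \<le> k"
  by (induction w arbitrary: C) (auto simp: length_step)

lemma last_mem_foldl: "w \<noteq> [] \<Longrightarrow> last w \<in> set (foldl step C w)"
  by (induction w arbitrary: C) (auto simp: mem_step)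

lemma card_diff_le_faults: "card (set w - set C) \<le> faults_from step C w"
proof (induction w arbitrary: C)
  case (Cons p w)
  have "set (p # w) - set C \<subseteq> ({p} - set C) \<union> (set w - set (step C p))"
    using step_subset[of C p] by auto
  then have "card (set (p # w) - set C) \<le> card (({p} - set C) \<union> (set w - set (step C p)))"
    by (intro card_mono) auto
  also have "\<dots> \<le> card ({p} - set C) + card (set w - set (step C p))"
    by (rule card_Un_le)
  also have "\<dots> \<le> faults_from step C (p # w)"
    using Cons[of "step C p"] by (simp add: insert_Diff_if)
  finally show ?case .
qed simp

text \<open>The page \<open>x\<close> occupies a slot of the initial cache, so at most
  \<open>k - 1\<close> pages of \<open>S\<close> are cached there; the first request to each of the
  others is a fault.\<close>

lemma faults_ge:
  assumes "length C \<le> k" "x \<in> set C" "x \<notin> S" "S \<subseteq> set w"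
  shows "card S + 1 \<le> faults_from step C w + k"
proof -
  have "card (set C) \<le> k"
    using assms(1) card_length le_trans by blast
  then have "card (set C - {x}) + 1 \<le> k"
    using assms(2) by (metis List.finite_set Suc_eq_plus1 card_Suc_Diff1)
  moreover have "S \<subseteq> (set w - set C) \<union> (set C - {x})"
    using assms by auto
  then have "card S \<le> card (set w - set C) + card (set C - {x})"
    by (meson card_Un_le card_mono finite_Diff finite_UnI le_trans List.finite_set)
  ultimately show ?thesis
    using card_diff_le_faults[of w C] by linarith
qed

end

lemma demand_paging_fifo:
  assumes "1 \<le> k"
  shows "demand_paging k (fifo_step k)"
  using assms by unfold_locales (auto simp: fifo_step_def bring_in_def dest: in_set_butlastD)

lemma demand_paging_lru:
  assumes "1 \<le> k"
  shows "demand_paging k (lru_step k)"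
  using assms
  by unfold_locales
    (auto simp: lru_step_def bring_in_def length_remove1 length_pos_if_in_set Suc_pred
      dest: in_set_butlastD set_remove1_subset[THEN subsetD])

subsection \<open>The LRU cache of a walk is an interval\<close>

text \<open>On either side of the current page \<open>p\<close>, nearer pages were requested more
  recently. How the two sides interleave depends on the history and is left open; LRU evicts only
  when \<open>p\<close> is an end of the window, and then one side is the whole list.\<close>

definition lru_window :: "nat \<Rightarrow> nat \<Rightarrow> nat \<Rightarrow> nat list \<Rightarrow> bool" where
  "lru_window a b p L \<longleftrightarrow> a \<le> p \<and> p \<le> b \<and> distinct L \<and>
     filter (\<lambda>x. x \<le> p) L = rev [a..<Suc p] \<and> filter (\<lambda>x. p \<le> x) L = [p..<Suc b]"

lemma lru_window_set:
  assumes "lru_window a b p L"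
  shows "set L = {a..b}"
proof -
  have "set L = set (filter (\<lambda>x. x \<le> p) L) \<union> set (filter (\<lambda>x. p \<le> x) L)"
    by auto
  also have "\<dots> = {a..b}"
    using assms unfolding lru_window_def by auto
  finally show ?thesis .
qed

lemma lru_window_length:
  assumes "lru_window a b p L"
  shows "length L = Suc b - a"
  using lru_window_set[OF assms] assms unfolding lru_window_def
  by (metis card_atLeastAtMost distinct_card)

lemma filter_remove1_distinct:
  "distinct L \<Longrightarrow> filter P (remove1 q L) = filter (\<lambda>x. P x \<and> x \<noteq> q) L"
  by (auto simp: distinct_remove1_removeAll removeAll_filter_not_eq intro: filter_cong)

text \<open>The page \<open>q\<close> becomes the head of both one-sided lists and the remaining
  entries keep their order. As \<open>q\<close> is adjacent to \<open>p\<close>, only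
  \<open>p\<close> and \<open>q\<close> can change sides.\<close>

lemma lru_window_hit:
  assumes w: "lru_window a b p L" and q: "adj p q" "q \<in> set L"
  shows "lru_window a b q (q # remove1 q L)"
proof -
  have le: "filter (\<lambda>x. x \<le> p) L = rev [a..<Suc p]" and ge: "filter (\<lambda>x. p \<le> x) L = [p..<Suc b]"
    and d: "distinct L" and ab: "a \<le> p" "p \<le> b"
    using w unfolding lru_window_def by auto
  have qab: "a \<le> q" "q \<le> b"
    using q(2) lru_window_set[OF w] by auto
  have le': "filter (\<lambda>x. x \<le> q \<and> x \<noteq> q) L = rev [a..<q]"
  proof (cases "q \<le> p")
    case True
    then have "filter (\<lambda>x. x \<le> q \<and> x \<noteq> q) L = filter (\<lambda>x. x < q) (filter (\<lambda>x. x \<le> p) L)"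
      by (auto intro: filter_cong)
    also have "\<dots> = rev (filter (\<lambda>x. x < q) [a..<Suc p])"
      by (simp only: le rev_filter)
    also have "filter (\<lambda>x. x < q) [a..<Suc p] = [a..<q]"
      using q(1) True qab ab by (auto simp: adj_def filter_id_conv filter_empty_conv)
    finally show ?thesis .
  next
    case False
    then have "filter (\<lambda>x. x \<le> q \<and> x \<noteq> q) L = filter (\<lambda>x. x \<le> p) L"
      using q(1) by (auto simp: adj_def intro!: filter_cong)
    then show ?thesis
      using False q(1) le by (auto simp: adj_def)
  qed
  have ge': "filter (\<lambda>x. q \<le> x \<and> x \<noteq> q) L = [Suc q..<Suc b]"
  proof (cases "p \<le> q")
    case True
    then have "filter (\<lambda>x. q \<le> x \<and> x \<noteq> q) L = filter (\<lambda>x. q < x) (filter (\<lambda>x. p \<le> x) L)"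
      by (auto intro: filter_cong)
    also have "\<dots> = filter (\<lambda>x. q < x) [p..<Suc b]"
      by (simp only: ge)
    also have "[p..<Suc b] = [p..<Suc q] @ [Suc q..<Suc b]"
      using True qab upt_add_eq_append[of p "Suc q" "b - q"] by simp
    also have "filter (\<lambda>x. q < x) \<dots> = [Suc q..<Suc b]"
      by (auto simp: filter_id_conv filter_empty_conv simp del: upt_Suc)
    finally show ?thesis .
  next
    case False
    then have "filter (\<lambda>x. q \<le> x \<and> x \<noteq> q) L = filter (\<lambda>x. p \<le> x) L"
      using q(1) by (auto simp: adj_def intro!: filter_cong)
    then show ?thesis
      using False q(1) ge by (auto simp: adj_def)
  qed
  show ?thesis
    using d qab le' upt_conv_Cons[of q "Suc b"] ge' unfolding lru_window_def
    by (simp add: filter_remove1_distinct del: upt.simps(2)) (simp add: upt_Suc)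
qed

text \<open>With the current page at the right end, the recency order is fixed completely: the last
  entry is \<open>a\<close>, the page farthest from the new request.\<close>

lemma lru_window_right:
  assumes w: "lru_window a b b L"
  shows "lru_window a (Suc b) (Suc b) (Suc b # L)" "lru_window (Suc a) (Suc b) (Suc b) (Suc b # butlast L)"
proof -
  have "filter (\<lambda>x. x \<le> b) L = L"
    using lru_window_set[OF w] by (simp add: filter_id_conv)
  then have L: "L = rev [a..<Suc b]" and ab: "a \<le> b"
    using w unfolding lru_window_def by auto
  show "lru_window a (Suc b) (Suc b) (Suc b # L)"
    using ab unfolding lru_window_def L by (auto simp: filter_id_conv filter_empty_conv)
  have "butlast L = rev [Suc a..<Suc b]"
    using ab unfolding L by (simp add: upt_conv_Cons del: upt_Suc)
  then show "lru_window (Suc a) (Suc b) (Suc b) (Suc b # butlast L)"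
    using ab unfolding lru_window_def by (auto simp: filter_id_conv filter_empty_conv)
qed

lemma lru_window_left:
  assumes w: "lru_window (Suc q) b (Suc q) L"
  shows "lru_window q b q (q # L)" "b \<noteq> 0" "lru_window q (b - 1) q (q # butlast L)"
proof -
  have "filter (\<lambda>x. Suc q \<le> x) L = L"
    using lru_window_set[OF w] by (simp add: filter_id_conv)
  then have L: "L = [Suc q..<Suc b]" and ab: "Suc q \<le> b"
    using w unfolding lru_window_def by auto
  show "lru_window q b q (q # L)"
    using ab unfolding lru_window_def L
    by (auto simp: filter_id_conv filter_empty_conv upt_conv_Cons simp del: upt_Suc)
  show "b \<noteq> 0" using ab by simp
  have "butlast L = [Suc q..<b]"
    using ab unfolding L by simp
  then show "lru_window q (b - 1) q (q # butlast L)"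
    using ab unfolding lru_window_def
    by (auto simp: filter_id_conv filter_empty_conv upt_conv_Cons simp del: upt_Suc)
qed

text \<open>A page outside the window can be adjacent to \<open>p\<close> only if \<open>p\<close>
  is an end of the window. This case rule drives the inductions over walks.\<close>

lemma lru_window_step:
  assumes w: "lru_window a b p L" and q: "adj p q" and k: "1 \<le> k" "length L \<le> k"
  obtains (hit) "q \<in> set L" "a \<le> q" "q \<le> b" "lru_window a b q (lru_step k L q)"
  | (right) "q \<notin> set L" "p = b" "q = Suc b" "length L < k" "lru_window a q q (lru_step k L q)"
  | (right_full) "q \<notin> set L" "p = b" "q = Suc b" "length L = k" "lru_window (Suc a) q q (lru_step k L q)"
  | (left) "q \<notin> set L" "p = a" "a = Suc q" "length L < k" "lru_window q b q (lru_step k L q)"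
  | (left_full) "q \<notin> set L" "p = a" "a = Suc q" "length L = k" "b \<noteq> 0"
      "lru_window q (b - 1) q (lru_step k L q)"
proof (cases "q \<in> set L")
  case True
  then show thesis
    using lru_window_hit[OF w q] lru_window_set[OF w] hit by (auto simp: lru_step_def)
next
  case False
  then have "q < a \<or> b < q"
    using lru_window_set[OF w] by auto
  moreover have "a \<le> p" "p \<le> b"
    using w unfolding lru_window_def by auto
  ultimately consider "p = b" "q = Suc b" | "p = a" "a = Suc q"
    using q unfolding adj_def by linarith
  then show thesis
  proof cases
    case 1
    then show thesis
      using False lru_window_right[of a b L] w k right right_full
      by (cases "length L < k") (auto simp: lru_step_def bring_in_def)
  next
    case 2
    then show thesis
      using False lru_window_left[of q b L] w k left left_full
      by (cases "length L < k") (auto simp: lru_step_def bring_in_def)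
  qed
qed

subsection \<open>LRU is optimal on walks\<close>

text \<open>Bounds how far LRU can fall behind another algorithm later on: \<open>r\<close> and \<open>l\<close> count the pages
  right and left of the current one in the other cache, \<open>u\<close> and \<open>v\<close> those in the LRU window. Running
  to the right forever, for instance, the other algorithm saves at most \<open>r - u\<close> faults.\<close>

definition lru_potential :: "int \<Rightarrow> int \<Rightarrow> int \<Rightarrow> int \<Rightarrow> int" where
  "lru_potential u v r l = max 0 (max (r - u) (l - v))"

lemma lru_potential_ge: "0 \<le> lru_potential u v r l" "r - u \<le> lru_potential u v r l" "l - v \<le> lru_potential u v r l"
  by (simp_all add: lru_potential_def)

lemma lru_potential_le_iff: "lru_potential u v r l \<le> x \<longleftrightarrow> 0 \<le> x \<and> r - u \<le> x \<and> l - v \<le> x"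
  by (simp add: lru_potential_def)

lemma lru_potential_mirror: "lru_potential u v r l = lru_potential v u l r"
  by (simp add: lru_potential_def max.commute)

text \<open>A move to the right that LRU hits. In the application \<open>c\<close> is 1 if the other
  algorithm hits too and 0 otherwise, so \<open>1 - c\<close> is its cost: a hit takes the new page
  out of the count \<open>r\<close>, a fault pays for the decrease of \<open>u\<close>.\<close>

lemma lru_potential_hit:
  assumes "r' + c \<le> r" "l' \<le> l + 1" "c \<le> 1"
  shows "lru_potential (u - 1) (v + 1) r' l' \<le> 1 - c + lru_potential u v r l"
  using assms lru_potential_ge[where u = u and v = v and r = r and l = l] unfolding lru_potential_le_iff
  by (intro conjI) linarith+

lemma lru_potential_fault:
  assumes "r' + c \<le> r" "l' \<le> l + 1" "c \<le> 1"
  shows "lru_potential 0 (v + 1) r' l' \<le> 1 - c + lru_potential 0 v r l"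
  using assms lru_potential_ge[where u = 0 and v = v and r = r and l = l] unfolding lru_potential_le_iff
  by (intro conjI) linarith+

text \<open>Here LRU pays for a fault without gaining a slot. The other cache is no larger than the
  window, so \<open>r' + l' \<le> v\<close> and the left surplus is not positive; if the other
  algorithm hits, the drop of \<open>r\<close> pays for the fault.\<close>

lemma lru_potential_fault_full:
  assumes "r' + c \<le> r" "c \<le> 1" "r' + l' \<le> v" "0 \<le> r'"
  shows "1 + lru_potential 0 v r' l' \<le> 1 - c + lru_potential 0 v r l"
proof -
  have "lru_potential 0 v r' l' \<le> lru_potential 0 v r l - c"
    using assms lru_potential_ge[where u = 0 and v = v and r = r and l = l] unfolding lru_potential_le_iff
  by (intro conjI) linarith+
  then show ?thesis by linarith
qed

lemma card_split_at:
  fixes F :: "'a :: linorder set"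
  assumes "finite F" "p \<in> F"
  shows "card {x \<in> F. p < x} + card {x \<in> F. x < p} + 1 = card F"
proof -
  have "F = {x \<in> F. p < x} \<union> ({x \<in> F. x < p} \<union> {p})"
    using assms(2) by auto
  also have "card \<dots> = card {x \<in> F. p < x} + card ({x \<in> F. x < p} \<union> {p})"
    using assms(1) by (intro card_Un_disjoint) auto
  also have "card ({x \<in> F. x < p} \<union> {p}) = card {x \<in> F. x < p} + 1"
    using assms(1) by (subst card_Un_disjoint) auto
  finally show ?thesis by simp
qed

lemma card_right_step:
  assumes "finite F" "F' \<subseteq> insert (Suc p) F"
  shows "card {x \<in> F'. Suc p < x} + (if Suc p \<in> F then 1 else 0) \<le> card {x \<in> F. p < x}"
    and "card {x \<in> F'. x < Suc p} \<le> Suc (card {x \<in> F. x < p})"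
proof -
  have "card ({x \<in> F'. Suc p < x} \<union> (if Suc p \<in> F then {Suc p} else {})) \<le> card {x \<in> F. p < x}"
    using assms by (intro card_mono) (auto split: if_splits)
  moreover have "finite {x \<in> F'. Suc p < x}"
    using assms by (auto intro: finite_subset)
  ultimately show "card {x \<in> F'. Suc p < x} + (if Suc p \<in> F then 1 else 0) \<le> card {x \<in> F. p < x}"
    by (auto split: if_splits)
  have "card {x \<in> F'. x < Suc p} \<le> card (insert p {x \<in> F. x < p})"
    using assms by (intro card_mono) auto
  also have "\<dots> \<le> Suc (card {x \<in> F. x < p})"
    by (rule card_insert_le_m1) auto
  finally show "card {x \<in> F'. x < Suc p} \<le> Suc (card {x \<in> F. x < p})" .
qed

lemma card_left_step:
  assumes "finite F" "F' \<subseteq> insert p F"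
  shows "card {x \<in> F'. x < p} + (if p \<in> F then 1 else 0) \<le> card {x \<in> F. x < Suc p}"
    and "card {x \<in> F'. p < x} \<le> Suc (card {x \<in> F. Suc p < x})"
proof -
  have "card ({x \<in> F'. x < p} \<union> (if p \<in> F then {p} else {})) \<le> card {x \<in> F. x < Suc p}"
    using assms by (intro card_mono) (auto split: if_splits)
  moreover have "finite {x \<in> F'. x < p}"
    using assms by (auto intro: finite_subset)
  ultimately show "card {x \<in> F'. x < p} + (if p \<in> F then 1 else 0) \<le> card {x \<in> F. x < Suc p}"
    by (auto split: if_splits)
  have "card {x \<in> F'. p < x} \<le> card (insert (Suc p) {x \<in> F. Suc p < x})"
    using assms by (intro card_mono) auto
  also have "\<dots> \<le> Suc (card {x \<in> F. Suc p < x})"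
    by (rule card_insert_le_m1) auto
  finally show "card {x \<in> F'. p < x} \<le> Suc (card {x \<in> F. Suc p < x})" .
qed

text \<open>An amortized comparison with an arbitrary demand paging algorithm. The potential bounds
  the future advantage of its cache \<open>C\<close>, and the free slots \<open>k - length L\<close>
  pay for the faults with which LRU fills its own.\<close>

lemma lru_dominates_from:
  assumes "demand_paging k step" "1 \<le> k"
    and "lru_window a b p L" "length L \<le> k" "length C \<le> k" "p \<in> set C" "successively adj (p # w)"
  shows "int (faults_from (lru_step k) L w) \<le> int (faults_from step C w)
           + (lru_potential (int b - int p) (int p - int a) (int (card {x \<in> set C. p < x})) (int (card {x \<in> set C. x < p}))
             + (int k - int (length L)))"
  using assms(3-)
proof (induction w arbitrary: a b p L C)
  case (Cons q w)
  interpret demand_paging k step by fact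
  interpret lru: demand_paging k "lru_step k" by (rule demand_paging_lru[OF assms(2)])
  let ?L = "lru_step k L q" and ?C = "step C q"
  have lens: "length ?L \<le> k" "length ?C \<le> k" and q: "q \<in> set ?C"
    using Cons.prems by (auto simp: length_step mem_step lru.length_step)
  have adj: "adj p q" and w: "successively adj (q # w)"
    using Cons.prems by auto
  have IH: "int (faults_from (lru_step k) ?L w) \<le> int (faults_from step ?C w)
      + (lru_potential (int b' - int q) (int q - int a') (int (card {x \<in> set ?C. q < x})) (int (card {x \<in> set ?C. x < q}))
         + (int k - int (length ?L)))"
    if "lru_window a' b' q ?L" for a' b'
    using Cons.IH[OF that lens q w] .
  have sub: "set ?C \<subseteq> insert q (set C)"
    by (rule step_subset)
  have len: "length L = Suc b - a" "a \<le> p" "p \<le> b"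
    using lru_window_length Cons.prems(1) unfolding lru_window_def by auto
  have tot: "int (card {x \<in> set ?C. q < x}) + int (card {x \<in> set ?C. x < q}) + 1 \<le> int k"
    using card_split_at[OF List.finite_set q] lens(2) card_length[of ?C] by linarith
  have stay: "int (card {x \<in> set ?C. q < x}) \<le> int (card {x \<in> set C. p < x})"
    "int (card {x \<in> set ?C. x < q}) \<le> int (card {x \<in> set C. x < p})" if "q = p"
    using sub that Cons.prems(4) by (auto intro!: card_mono)
  have right: "int (card {x \<in> set ?C. q < x}) + (if q \<in> set C then 1 else 0) \<le> int (card {x \<in> set C. p < x})"
    "int (card {x \<in> set ?C. x < q}) \<le> int (card {x \<in> set C. x < p}) + 1" if "q = Suc p"
    using card_right_step[of "set C" "set ?C" p] sub that by (auto split: if_splits)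
  have left: "int (card {x \<in> set ?C. x < q}) + (if q \<in> set C then 1 else 0) \<le> int (card {x \<in> set C. x < p})"
    "int (card {x \<in> set ?C. q < x}) \<le> int (card {x \<in> set C. p < x}) + 1" if "p = Suc q"
    using card_left_step[of "set C" "set ?C" q] sub that by (auto split: if_splits)
  have lru_cons: "int (faults_from (lru_step k) L (q # w))
      = (if q \<in> set L then 0 else 1) + int (faults_from (lru_step k) ?L w)"
    and alg_cons: "int (faults_from step C (q # w)) = (if q \<in> set C then 0 else 1) + int (faults_from step ?C w)"
    by simp_all
  define r l r' l' c where "r = int (card {x \<in> set C. p < x})" and "l = int (card {x \<in> set C. x < p})"
    and "r' = int (card {x \<in> set ?C. q < x})" and "l' = int (card {x \<in> set ?C. x < q})"
    and "c = (if q \<in> set C then 1 else 0 :: int)"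
  note defs = this
  have c: "c \<le> 1"
    by (simp add: c_def)
  have alg_cons': "int (faults_from step C (q # w)) = 1 - c + int (faults_from step ?C w)"
    by (simp add: alg_cons c_def)
  note right = right[folded defs] and left = left[folded defs] and stay = stay[folded defs]
    and tot = tot[folded defs]
  have nonneg: "0 \<le> r'" "0 \<le> l'"
    by (simp_all add: defs)
  \<comment> \<open>Reduces each case to one amortized inequality: the cost of LRU plus the new
    potential is at most the cost of the other algorithm plus the old potential, where a gained slot
    counts as credit.\<close>
  have final: ?case
    if "lru_window a' b' q ?L"
      and "lru_potential (int b' - int q) (int q - int a') r' l' + (if q \<in> set L then 0 else 1) + int (length L)
        \<le> 1 - c + lru_potential (int b - int p) (int p - int a) r l + int (length ?L)" for a' b'
    using IH[OF that(1), folded defs] that(2) unfolding lru_cons alg_cons' defs(1-4)[symmetric] by linarith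
  show ?case
    using Cons.prems(1) adj assms(2) Cons.prems(2)
  proof (cases rule: lru_window_step)
    case hit
    have len': "length ?L = length L"
      using lru_window_length[OF hit(4)] len(1) by simp
    consider "q = p" | "q = Suc p" | "p = Suc q"
      using adj unfolding adj_def by blast
    then show ?thesis
    proof cases
      case 1
      then have "c = 1"
        using Cons.prems(4) by (simp add: c_def)
      moreover have "lru_potential (int b - int q) (int q - int a) r' l'
          \<le> lru_potential (int b - int p) (int p - int a) r l"
        using stay[OF 1] 1 lru_potential_ge[where u = "int b - int p" and v = "int p - int a" and r = r and l = l]
        unfolding lru_potential_le_iff by simp
      ultimately show ?thesis
        using hit(1) len' by (intro final[OF hit(4)]) simp
    next
      case 2
      have eqs: "int b - int q = int b - int p - 1" "int q - int a = int p - int a + 1"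
        using 2 by simp_all
      have "lru_potential (int b - int q) (int q - int a) r' l'
          \<le> 1 - c + lru_potential (int b - int p) (int p - int a) r l"
        unfolding eqs by (rule lru_potential_hit[OF right[OF 2] c])
      then show ?thesis
        using hit(1) len' by (intro final[OF hit(4)]) simp
    next
      case 3
      have eqs: "int b - int q = int b - int p + 1" "int q - int a = int p - int a - 1"
        using 3 by simp_all
      \<comment> \<open>A move to the left is a move to the right with the sides exchanged;
        \<open>lru_potential_mirror\<close> translates back.\<close>
      have "lru_potential (int q - int a) (int b - int q) l' r'
          \<le> 1 - c + lru_potential (int p - int a) (int b - int p) l r"
        unfolding eqs by (rule lru_potential_hit[OF left[OF 3] c])
      then show ?thesis
        using hit(1) len' by (intro final[OF hit(4)]) (simp add: lru_potential_mirror[of _ _ r' l']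
          lru_potential_mirror[of _ _ r l])
    qed
  next
    case R: right
    have qp: "q = Suc p"
      using R by simp
    have eqs: "int q - int q = 0" "int q - int a = int p - int a + 1" "int b - int p = 0"
      using qp R by simp_all
    have "lru_potential (int q - int q) (int q - int a) r' l'
        \<le> 1 - c + lru_potential (int b - int p) (int p - int a) r l"
      unfolding eqs by (rule lru_potential_fault[OF right[OF qp] c])
    moreover have "length ?L = Suc (length L)"
      using lru_window_length[OF R(5)] len R by simp
    ultimately show ?thesis
      using R(1) by (intro final[OF R(5)]) simp
  next
    case R: right_full
    have qp: "q = Suc p"
      using R by simp
    have eqs: "int q - int q = 0" "int q - int (Suc a) = int p - int a" "int b - int p = 0"
      using qp R by simp_all
    \<comment> \<open>A full cache with \<open>p\<close> at its right end means
      \<open>k = p - a + 1\<close>, and \<open>q\<close> itself takes one of the at most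
      \<open>k\<close> slots of the other cache.\<close>
    have "r' + l' \<le> int p - int a"
      using tot R(2,4) len by simp
    then have "1 + lru_potential (int q - int q) (int q - int (Suc a)) r' l'
        \<le> 1 - c + lru_potential (int b - int p) (int p - int a) r l"
      unfolding eqs using right(1)[OF qp] c nonneg(1) by (intro lru_potential_fault_full)
    moreover have "length ?L = length L"
      using lru_window_length[OF R(5)] len R by simp
    ultimately show ?thesis
      using R(1) by (intro final[OF R(5)]) simp
  next
    case Lf: left
    have qp: "p = Suc q"
      using Lf by simp
    have eqs: "int q - int q = 0" "int b - int q = int b - int p + 1" "int p - int a = 0"
      using qp Lf by simp_all
    have "lru_potential (int q - int q) (int b - int q) l' r'
        \<le> 1 - c + lru_potential (int p - int a) (int b - int p) l r"
      unfolding eqs by (rule lru_potential_fault[OF left[OF qp] c])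
    moreover have "length ?L = Suc (length L)"
      using lru_window_length[OF Lf(5)] len Lf by simp
    ultimately show ?thesis
      using Lf(1) by (intro final[OF Lf(5)]) (simp add: lru_potential_mirror[of _ _ r' l']
        lru_potential_mirror[of _ _ r l])
  next
    case Lf: left_full
    have qp: "p = Suc q"
      using Lf by simp
    have eqs: "int q - int q = 0" "int (b - 1) - int q = int b - int p" "int p - int a = 0"
      using qp Lf by (simp_all add: of_nat_diff)
    have "l' + r' \<le> int b - int p"
      using tot Lf(2,4) len by simp
    then have "1 + lru_potential (int q - int q) (int (b - 1) - int q) l' r'
        \<le> 1 - c + lru_potential (int p - int a) (int b - int p) l r"
      unfolding eqs using left(1)[OF qp] c nonneg(2) by (intro lru_potential_fault_full)
    moreover have "length ?L = length L"
      using lru_window_length[OF Lf(6)] len Lf by simp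
    ultimately show ?thesis
      using Lf(1) by (intro final[OF Lf(6)]) (simp add: lru_potential_mirror[of _ _ r' l']
        lru_potential_mirror[of _ _ r l])
  qed
qed (simp add: lru_potential_ge(1) add_nonneg_nonneg)

lemma lru_window_single: "lru_window p p p [p]"
  by (simp add: lru_window_def)

lemma LRU_le_FIFO:
  assumes "1 \<le> k" "successively adj J"
  shows "LRU k J \<le> FIFO k J + k"
proof (cases J)
  case (Cons p w)
  then show ?thesis
    using assms lru_dominates_from[OF demand_paging_fifo[OF assms(1)] assms(1) lru_window_single[of p], of "[p]" w]
    by (auto simp: LRU_def FIFO_def lru_step_def fifo_step_def bring_in_def lru_potential_def)
qed (simp add: LRU_def)

text \<open>A full window is \<open>{0..k - 1}\<close> or \<open>{1..k}\<close>, so a fault with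
  full cache requests \<open>k\<close> or \<open>0\<close>. Every other fault lengthens
  \<open>L\<close>, which the left side of the inequality counts.\<close>

lemma lru_faults_le_ends_from:
  assumes "1 \<le> k" "lru_window a b p L" "length L \<le> k" "b \<le> k" "set w \<subseteq> {..k}" "successively adj (p # w)"
  shows "faults_from (lru_step k) L w + length L \<le> k + (count_list w 0 + count_list w k)"
  using assms(2-)
proof (induction w arbitrary: a b p L)
  case (Cons q w)
  interpret demand_paging k "lru_step k" by (rule demand_paging_lru[OF assms(1)])
  let ?L = "lru_step k L q"
  have lens: "length ?L \<le> k"
    using Cons.prems by (auto simp: length_step)
  have adj: "adj p q" and w: "set w \<subseteq> {..k}" "successively adj (q # w)" and q: "q \<le> k"
    using Cons.prems by auto
  have len: "length L = Suc b - a" "a \<le> p" "p \<le> b"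
    using lru_window_length Cons.prems(1) unfolding lru_window_def by auto
  note IH = Cons.IH[OF _ lens _ w]
  show ?case
    using Cons.prems(1) adj assms(1) Cons.prems(2)
  proof (cases rule: lru_window_step)
    case hit
    show ?thesis
      using hit(1) IH[OF hit(4) Cons.prems(3)] lru_window_length[OF hit(4)] len by (auto split: if_splits)
  next
    case r: right
    show ?thesis
      using r(1-4) IH[OF r(5) q] lru_window_length[OF r(5)] len
      by (cases "q = k"; cases "q = 0") auto
  next
    case r: right_full
    show ?thesis
      using r(1-4) IH[OF r(5) q] lru_window_length[OF r(5)] len q by auto
  next
    case l: left
    show ?thesis
      using l(1-4) IH[OF l(5) Cons.prems(3)] lru_window_length[OF l(5)] len
      by (cases "q = k"; cases "q = 0") auto
  next
    case l: left_full
    show ?thesis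
      using l(1-5) IH[OF l(6)] lru_window_length[OF l(6)] len Cons.prems(3) by auto
  qed
qed simp

lemma LRU_le_ends:
  assumes "1 \<le> k" "set J \<subseteq> {..k}" "successively adj J"
  shows "LRU k J \<le> k + (count_list J 0 + count_list J k)"
proof (cases J)
  case (Cons p w)
  then show ?thesis
    using assms lru_faults_le_ends_from[OF assms(1) lru_window_single[of p], of w]
    by (auto simp: LRU_def lru_step_def bring_in_def)
qed (simp add: LRU_def)

subsection \<open>FIFO fault phases and edge crossings\<close>

text \<open>Read \<open>H\<close> as the history of faulted pages, newest first: the FIFO cache is
  always its first \<open>k\<close> entries.\<close>

lemma fifo_step_take:
  assumes "1 \<le> k" "x \<notin> set (take k H)"
  shows "fifo_step k (take k H) x = take k (x # H)"
proof (cases "length H < k")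
  case True
  then show ?thesis
    using assms(2) by (simp add: fifo_step_def bring_in_def)
next
  case False
  then show ?thesis
    using assms by (cases k) (simp_all add: fifo_step_def bring_in_def butlast_take)
qed

text \<open>A newly faulted page differs from all cached ones, which are the last \<open>k\<close>
  faulted pages. The equation for the cache is the invariant from which the distinctness
  follows.\<close>

lemma fifo_fault_times:
  assumes "1 \<le> k"
  shows "\<exists>ts. sorted_wrt (<) ts \<and> (\<forall>t \<in> set ts. t < length J) \<and> length ts = FIFO k J \<and>
    foldl (fifo_step k) [] J = take k (rev (map ((!) J) ts)) \<and>
    (\<forall>i j. i < j \<and> j < length ts \<and> j \<le> i + k \<longrightarrow> J ! (ts ! i) \<noteq> J ! (ts ! j))"
proof (induction J rule: rev_induct)
  case Nil
  then show ?case by (simp add: FIFO_def)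
next
  case (snoc x J)
  then obtain ts where ts: "sorted_wrt (<) ts" "\<forall>t \<in> set ts. t < length J" "length ts = FIFO k J"
    "foldl (fifo_step k) [] J = take k (rev (map ((!) J) ts))"
    "\<forall>i j. i < j \<and> j < length ts \<and> j \<le> i + k \<longrightarrow> J ! (ts ! i) \<noteq> J ! (ts ! j)"
    by blast
  let ?S = "take k (rev (map ((!) J) ts))"
  have map_eq: "map ((!) (J @ [x])) ts = map ((!) J) ts"
    using ts(2) by (auto simp: nth_append)
  have nth_eq: "(J @ [x]) ! (ts ! i) = J ! (ts ! i)" if "i < length ts" for i
    using ts(2) that by (auto simp: nth_append)
  show ?case
  proof (cases "x \<in> set ?S")
    case True
    then have "fifo_step k ?S x = ?S"
      by (simp add: fifo_step_def)
    then show ?thesis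
      using ts True by (intro exI[of _ ts]) (auto simp: FIFO_def faults_from_append map_eq nth_eq)
  next
    case False
    let ?ts = "ts @ [length J]"
    have "fifo_step k ?S x = take k (x # rev (map ((!) J) ts))"
      by (rule fifo_step_take[OF assms False])
    moreover have "(J @ [x]) ! (?ts ! i) \<noteq> (J @ [x]) ! (?ts ! j)"
      if "i < j" "j < length ?ts" "j \<le> i + k" for i j
    proof (cases "j < length ts")
      case True
      then show ?thesis
        using ts(5) that nth_eq[of i] nth_eq[of j] by (auto simp: nth_append[of ts])
    next
      case j: False
      then have j: "j = length ts" and i: "i < length ts"
        using that by auto
      have "J ! (ts ! i) = ?S ! (length ts - 1 - i)"
        using that i j by (simp add: rev_nth)
      also have "\<dots> \<in> set ?S"
        using that i j by (intro nth_mem) auto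
      finally have "J ! (ts ! i) \<noteq> x"
        using False by metis
      then show ?thesis
        using i j nth_eq[OF i] by (simp add: nth_append[of ts])
    qed
    ultimately show ?thesis
      using ts False by (intro exI[of _ ?ts])
        (auto simp: FIFO_def faults_from_append map_eq sorted_wrt_append)
  qed
qed

text \<open>The edge between \<open>v\<close> and \<open>Suc v\<close> is named by its lower end.
  Times are collected, not counted, so that each phase can claim those inside its own time
  interval.\<close>

definition crossings :: "nat list \<Rightarrow> nat \<Rightarrow> nat set" where
  "crossings J v = {t. Suc t < length J \<and> {J ! t, J ! Suc t} = {v, Suc v}}"

lemma finite_crossings: "finite (crossings J v)"
  by (rule finite_subset[of _ "{..<length J}"]) (auto simp: crossings_def)

text \<open>A discrete intermediate value theorem: \<open>adj\<close> never jumps over an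
  edge.\<close>

lemma crossing_between:
  assumes "successively adj J" "i \<le> j" "j < length J"
    and "J ! i \<le> v \<and> v < J ! j \<or> J ! j \<le> v \<and> v < J ! i"
  shows "\<exists>t \<in> crossings J v. i \<le> t \<and> t < j"
  using assms(2-4)
proof (induction j rule: dec_induct)
  case base
  then have False by linarith
  then show ?case ..
next
  case (step j)
  have adj: "adj (J ! j) (J ! Suc j)"
    using assms(1) step.prems(1) by (simp add: successively_conv_nth)
  show ?case
  proof (cases "J ! i \<le> v \<and> v < J ! j \<or> J ! j \<le> v \<and> v < J ! i")
    case True
    then show ?thesis
      using step.IH step.prems(1) by fastforce
  next
    case False
    then have "J ! j = v \<and> J ! Suc j = Suc v \<or> J ! j = Suc v \<and> J ! Suc j = v"
      using adj step.prems(2) unfolding adj_def by linarith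
    then have "j \<in> crossings J v"
      using step.prems(1) unfolding crossings_def by auto
    then show ?thesis
      using step.hyps by auto
  qed
qed

lemma crossing_mem:
  assumes "t \<in> crossings J v"
  shows "Suc t < length J" "v \<in> {J ! t, J ! Suc t}" "Suc v \<in> {J ! t, J ! Suc t}"
proof -
  show "Suc t < length J"
    using assms unfolding crossings_def by blast
  have eq: "{J ! t, J ! Suc t} = {v, Suc v}"
    using assms unfolding crossings_def by blast
  show "v \<in> {J ! t, J ! Suc t}" "Suc v \<in> {J ! t, J ! Suc t}"
    unfolding eq by simp_all
qed

lemma crossing_vertices:
  assumes "t \<in> crossings J v"
  shows "v \<in> set J" "Suc v \<in> set J"
  using crossing_mem[OF assms] nth_mem[of t J] nth_mem[of "Suc t" J] by auto

text \<open>A handshake count: crossings of the two edges at \<open>v\<close> are steps into or out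
  of an occurrence of \<open>v\<close>, and each occurrence has at most two such steps. Vertex 0 has
  no lower edge.\<close>

lemma card_crossings_le_count:
  "card (crossings J v) + (if v = 0 then 0 else card (crossings J (v - 1))) \<le> 2 * count_list J v"
proof -
  let ?O = "{t. t < length J \<and> J ! t = v}" and ?E = "if v = 0 then {} else crossings J (v - 1)"
  have O: "card ?O = count_list J v"
    by (simp add: count_list_eq_length_filter length_filter_conv_card eq_commute)
  have "crossings J v \<inter> ?E = {}"
    by (auto simp: crossings_def doubleton_eq_iff)
  then have "card (crossings J v) + card ?E = card (crossings J v \<union> ?E)"
    by (subst card_Un_disjoint) (auto simp: finite_crossings)
  also have "\<dots> \<le> card (?O \<union> {t. Suc t \<in> ?O})"
  proof (rule card_mono)
    show "finite (?O \<union> {t. Suc t \<in> ?O})"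
      by (rule finite_subset[of _ "{..<length J}"]) auto
    have "t \<in> ?O \<union> {t. Suc t \<in> ?O}" if "Suc t < length J" "v \<in> {J ! t, J ! Suc t}" for t
      using that by auto
    moreover have "Suc t < length J \<and> v \<in> {J ! t, J ! Suc t}" if "t \<in> crossings J v \<union> ?E" for t
      using that crossing_mem[of t J v] crossing_mem[of t J "v - 1"] by (cases "v = 0") auto
    ultimately show "crossings J v \<union> ?E \<subseteq> ?O \<union> {t. Suc t \<in> ?O}"
      by blast
  qed
  also have "\<dots> \<le> card ?O + card {t. Suc t \<in> ?O}"
    by (rule card_Un_le)
  also have "card {t. Suc t \<in> ?O} = card (Suc ` {t. Suc t \<in> ?O})"
    by (simp add: card_image)
  also have "\<dots> \<le> card ?O"
    by (intro card_mono) auto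
  finally show ?thesis
    by (simp add: O split: if_splits)
qed

text \<open>The pages of the faults \<open>0, ..., L\<close> are distinct, hence spread over at
  least \<open>L\<close> edges. A phase that ends on its first page crosses each edge and comes
  back, any other crosses it at least once; \<open>k + 2 - L\<close> encodes these numbers 2 and
  1.\<close>

lemma phase_crossings:
  assumes walk: "successively adj J"
    and sorted: "\<And>i j. i < j \<Longrightarrow> j \<le> Suc k \<Longrightarrow> t i < t j"
    and len: "t (Suc k) < length J"
    and distinct: "\<And>i j. i < j \<Longrightarrow> j \<le> Suc k \<Longrightarrow> j \<le> i + k \<Longrightarrow> J ! t i \<noteq> J ! t j"
  shows "\<exists>x L. L \<in> {k, Suc k} \<and>
    (\<forall>v. x \<le> v \<and> v < x + L \<longrightarrow> k + 2 - L \<le> card (crossings J v \<inter> {t 0..<t (Suc k)}))"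
proof -
  define closed where "closed \<longleftrightarrow> J ! t 0 = J ! t (Suc k)"
  define L where "L = (if closed then k else Suc k)"
  define S where "S = (\<lambda>i. J ! t i) ` {..L}"
  have L: "L \<le> Suc k" by (simp add: L_def)
  have "inj_on (\<lambda>i. J ! t i) {..L}"
  proof (rule linorder_inj_onI)
    fix i j assume ij: "i < j" "i \<in> {..L}" "j \<in> {..L}"
    show "J ! t i \<noteq> J ! t j"
    proof (cases "j \<le> i + k")
      case False
      then have "i = 0" "j = Suc k" "\<not> closed"
        using ij L by (auto simp: L_def split: if_splits)
      then show ?thesis by (simp add: closed_def)
    qed (use distinct ij L in auto)
  qed auto
  then have "card S = Suc L"
    by (simp add: S_def card_image)
  define x where "x = Min S"
  have fin: "finite S" "S \<noteq> {}"
    by (auto simp: S_def)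
  have "S \<subseteq> {x..Max S}"
    using fin by (auto simp: x_def)
  then have "Suc L \<le> Suc (Max S) - x"
    using card_mono[of "{x..Max S}" S] \<open>card S = Suc L\<close> by simp
  then have range: "x + L \<le> Max S"
    by linarith
  have time: "\<exists>s. t 0 \<le> s \<and> s \<le> t (Suc k) \<and> J ! s = y" if y: "y \<in> S" for y
  proof -
    obtain i where i: "i \<le> L" "y = J ! t i"
      using y by (auto simp: S_def)
    have "t 0 \<le> t i"
      using sorted[of 0 i] i L by (cases "i = 0") auto
    moreover have "t i \<le> t (Suc k)"
      using sorted[of i "Suc k"] i L by (cases "i = Suc k") auto
    ultimately show ?thesis
      using i by blast
  qed
  obtain s1 where s1: "t 0 \<le> s1" "s1 \<le> t (Suc k)" "J ! s1 = x"
    using time[of x] fin by (auto simp: x_def)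
  obtain s2 where s2: "t 0 \<le> s2" "s2 \<le> t (Suc k)" "J ! s2 = Max S"
    using time[of "Max S"] fin by auto
  have "k + 2 - L \<le> card (crossings J v \<inter> {t 0..<t (Suc k)})" if v: "x \<le> v" "v < x + L" for v
  proof (cases closed)
    case True
    \<comment> \<open>An extreme page on the other side of the edge from the start: reaching it and
      returning give crossings at two different times.\<close>
    define s where "s = (if J ! t 0 \<le> v then s2 else s1)"
    have s: "t 0 \<le> s" "s \<le> t (Suc k)" "J ! t 0 \<le> v \<longleftrightarrow> v < J ! s"
      using s1 s2 v range by (auto simp: s_def)
    obtain c1 where c1: "c1 \<in> crossings J v" "t 0 \<le> c1" "c1 < s"
      using crossing_between[OF walk, of "t 0" s v] s len by auto
    obtain c2 where c2: "c2 \<in> crossings J v" "s \<le> c2" "c2 < t (Suc k)"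
      using crossing_between[OF walk, of s "t (Suc k)" v] s len True by (auto simp: closed_def)
    have "card {c1, c2} \<le> card (crossings J v \<inter> {t 0..<t (Suc k)})"
      using c1 c2 by (intro card_mono) auto
    moreover have "c1 \<noteq> c2"
      using c1 c2 by simp
    ultimately show ?thesis
      using True by (simp add: L_def)
  next
    case False
    obtain c where "c \<in> crossings J v" "min s1 s2 \<le> c" "c < max s1 s2"
      using crossing_between[OF walk, of "min s1 s2" "max s1 s2" v] s1 s2 v range len
      by (cases "s1 \<le> s2") (auto simp: min_def max_def)
    then have c: "c \<in> crossings J v" "t 0 \<le> c" "c < t (Suc k)"
      using s1 s2 by auto
    have "card {c} \<le> card (crossings J v \<inter> {t 0..<t (Suc k)})"
      using c by (intro card_mono) auto
    then show ?thesis
      using False by (simp add: L_def)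
  qed
  moreover have "L \<in> {k, Suc k}"
    by (simp add: L_def)
  ultimately show ?thesis by blast
qed

subsection \<open>Reordering for LRU\<close>

lemma card_consecutive_intervals:
  fixes T :: "nat \<Rightarrow> nat"
  assumes "finite A" "\<And>m. m < M \<Longrightarrow> T m \<le> T (Suc m)"
  shows "(\<Sum>m<M. card (A \<inter> {T m..<T (Suc m)})) \<le> card A"
proof -
  have "T 0 \<le> T M \<and> (\<Sum>m<M. card (A \<inter> {T m..<T (Suc m)})) = card (A \<inter> {T 0..<T M})"
    using assms(2)
  proof (induction M)
    case (Suc M)
    have le: "T 0 \<le> T M" "T M \<le> T (Suc M)"
      using Suc by auto
    then have "A \<inter> {T 0..<T (Suc M)} = (A \<inter> {T 0..<T M}) \<union> (A \<inter> {T M..<T (Suc M)})"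
      by auto
    also have "card \<dots> = card (A \<inter> {T 0..<T M}) + card (A \<inter> {T M..<T (Suc M)})"
      using assms(1) by (intro card_Un_disjoint) auto
    finally show ?case
      using Suc le order_trans[OF le] by simp
  qed simp
  then show ?thesis
    using assms(1) by (simp add: card_mono)
qed

lemma walk_set:
  assumes "successively adj J" "J \<noteq> []"
  shows "\<exists>l r. l \<le> r \<and> set J = {l..r}"
  using assms
proof (induction J)
  case (Cons p J)
  show ?case
  proof (cases "J = []")
    case True
    then show ?thesis by (intro exI[of _ p]) auto
  next
    case False
    then obtain l r where lr: "l \<le> r" "set J = {l..r}" and "adj p (hd J)"
      using Cons by (auto simp: successively_Cons)
    moreover have "hd J \<in> set J"
      using False by simp
    ultimately consider "p \<in> {l..r}" | "p = Suc r" | "Suc p = l"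
      unfolding adj_def by fastforce
    then show ?thesis
    proof cases
      case 1
      then have "set (p # J) = {l..r}"
        by (simp add: lr(2) insert_absorb)
      then show ?thesis using lr(1) by blast
    next
      case 2
      then have "set (p # J) = {l..p}"
        using lr by (simp add: atLeastAtMostSuc_conv)
      then show ?thesis using 2 lr(1) by (metis le_SucI)
    next
      case 3
      then have "set (p # J) = {p..r}"
        using lr by (simp add: atLeastAtMost_insertL flip: 3)
      then show ?thesis using 3 lr(1) by (metis Suc_leD)
    qed
  qed
qed simp

text \<open>A round trip from \<open>x\<close> to \<open>x + L\<close> with the initial
  \<open>x\<close> left out, so that it can be appended to any walk that is at
  \<open>x\<close>.\<close>

definition loop :: "nat \<Rightarrow> nat \<Rightarrow> nat list" where
  "loop x L = [Suc x..<Suc (x + L)] @ rev [x..<x + L]"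

lemma count_list_upt: "count_list [a..<b] v = of_bool (a \<le> v \<and> v < b)"
  by (induction b) auto

text \<open>One request to \<open>v\<close> for each edge of the interval at \<open>v\<close>, in
  the same way as \<open>card_crossings_le_count\<close> charges crossings to
  \<open>v\<close>.\<close>

lemma count_list_loop:
  "count_list (loop x L) v = of_bool (x < v \<and> v \<le> x + L) + of_bool (x \<le> v \<and> v < x + L)"
  by (auto simp: loop_def count_list_upt simp del: upt_Suc)

lemma count_list_concat_replicate: "count_list (concat (replicate n w)) v = n * count_list w v"
  by (induction n) auto

lemma count_list_replicate: "count_list (replicate n x) v = (if x = v then n else 0)"
  by (induction n) auto

definition excursion :: "nat \<Rightarrow> nat list \<Rightarrow> bool" where
  "excursion x w \<longleftrightarrow> successively adj (x # w) \<and> last (x # w) = x"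

lemma excursion_append: "excursion x u \<Longrightarrow> excursion x w \<Longrightarrow> excursion x (u @ w)"
  by (cases "u = []"; cases "w = []")
    (auto simp: excursion_def successively_append_iff successively_Cons)

lemma excursion_concat_replicate: "excursion x w \<Longrightarrow> excursion x (concat (replicate n w))"
  by (induction n) (auto intro: excursion_append simp: excursion_def[of _ "[]"])

lemma excursion_replicate: "excursion x (replicate n x)"
  by (induction n) (auto simp: excursion_def adj_def successively_Cons)

lemma successively_adj_upt: "successively adj [a..<b]"
  by (induction b) (auto simp: successively_append_iff adj_def)

lemma successively_adj_rev: "successively adj (rev xs) \<longleftrightarrow> successively adj xs"
proof -
  have "(\<lambda>x y. adj y x) = adj"
    by (auto simp: adj_def fun_eq_iff)
  then show ?thesis by (simp only: successively_rev)
qed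

lemma excursion_loop:
  assumes "1 \<le> L"
  shows "excursion x (loop x L)"
proof -
  obtain n where n: "x + L = Suc n" "x \<le> n"
    using assms by (cases L) auto
  have "x # loop x L = [x..<Suc (x + L)] @ rev [x..<x + L]"
    by (simp add: loop_def upt_conv_Cons del: upt_Suc)
  moreover have "successively adj ([x..<Suc (x + L)] @ rev [x..<x + L])"
  proof -
    have "adj (last [x..<Suc (x + L)]) (hd (rev [x..<x + L]))"
      using n by (simp add: adj_def hd_rev)
    then show ?thesis
      by (simp add: successively_append_iff successively_adj_rev successively_adj_upt del: upt_Suc successively_rev)
  qed
  moreover have "last ([x..<Suc (x + L)] @ rev [x..<x + L]) = x"
    using n by (simp add: last_rev del: upt_Suc)
  ultimately show ?thesis
    by (simp add: excursion_def)
qed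

text \<open>The skeleton of the reordered walk: one sweep from \<open>l\<close> to \<open>r\<close>,
  interrupted at each vertex by an excursion that returns there.\<close>

lemma walk_sweep:
  assumes "\<And>x. excursion x (t x)" "l \<le> r"
  shows "successively adj (concat (map (\<lambda>x. x # t x) [l..<Suc r])) \<and>
    last (concat (map (\<lambda>x. x # t x) [l..<Suc r])) = r"
  using assms(2)
proof (induction r rule: dec_induct)
  case base
  then show ?case using assms(1)[of l] by (simp add: excursion_def)
next
  case (step r)
  let ?S = "concat (map (\<lambda>x. x # t x) [l..<Suc r])"
  have "concat (map (\<lambda>x. x # t x) [l..<Suc (Suc r)]) = ?S @ (Suc r # t (Suc r))"
    using step.hyps by simp
  moreover have "adj (last ?S) (Suc r)"
    using step.IH by (simp add: adj_def)
  ultimately show ?case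
    using step.IH assms(1)[of "Suc r"]
    by (simp add: excursion_def successively_append_iff del: upt_Suc)
qed

context demand_paging
begin

text \<open>The bound for \<open>w\<close> is required for every cache containing \<open>x\<close>,
  so that only the presence of \<open>x\<close> has to be known after each round.\<close>

lemma faults_concat_replicate_ge:
  assumes "\<And>C. length C \<le> k \<Longrightarrow> x \<in> set C \<Longrightarrow> c \<le> faults_from step C w"
    and "last (x # w) = x" "length C \<le> k" "x \<in> set C"
  shows "n * c \<le> faults_from step C (concat (replicate n w))"
  using assms(3,4)
proof (induction n arbitrary: C)
  case (Suc n)
  have "x \<in> set (foldl step C w)"
    using last_mem_foldl[of w C] Suc.prems assms(2) by (cases "w = []") auto
  then have "n * c \<le> faults_from step (foldl step C w) (concat (replicate n w))"
    using Suc by (simp add: length_foldl)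
  then show ?case
    using assms(1)[OF Suc.prems] by (simp add: faults_from_append)
qed simp

lemma faults_sweep_ge:
  assumes "\<And>C x. length C \<le> k \<Longrightarrow> x \<in> set C \<Longrightarrow> f x \<le> faults_from step C (t x)" "length C \<le> k"
  shows "sum_list (map f xs) \<le> faults_from step C (concat (map (\<lambda>x. x # t x) xs))"
  using assms(2)
proof (induction xs arbitrary: C)
  case (Cons x xs)
  have "f x \<le> faults_from step (step C x) (t x)"
    using assms(1) Cons.prems by (simp add: length_step mem_step)
  moreover have "sum_list (map f xs) \<le> faults_from step (foldl step (step C x) (t x)) (concat (map (\<lambda>x. x # t x) xs))"
    using Cons by (simp add: length_foldl length_step)
  ultimately show ?case
    by (simp add: faults_from_append)
qed simp

end

text \<open>Each half of the trip starts at a cached page and requests \<open>L\<close> others, so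
  \<open>faults_ge\<close> gives \<open>L + 1 - k\<close> faults per half: 2 in all for
  \<open>L = k\<close> and 4 for \<open>L = Suc k\<close>.\<close>

lemma faults_loop_ge:
  assumes "demand_paging k step" "1 \<le> L" "length C \<le> k" "x \<in> set C"
  shows "2 * (L + 1 - k) \<le> faults_from step C (loop x L)"
proof -
  interpret demand_paging k step by fact
  let ?u = "[Suc x..<Suc (x + L)]" and ?w = "rev [x..<x + L]"
  have "card {Suc x..<Suc (x + L)} + 1 \<le> faults_from step C ?u + k"
    using assms by (intro faults_ge[where x = x]) (auto simp del: upt_Suc)
  moreover have "x + L \<in> set (foldl step C ?u)"
    using last_mem_foldl[of ?u C] assms(2) by simp
  then have "card {x..<x + L} + 1 \<le> faults_from step (foldl step C ?u) ?w + k"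
    using assms by (intro faults_ge[where x = "x + L"]) (auto simp: length_foldl simp del: upt_Suc)
  ultimately show ?thesis
    by (simp add: loop_def faults_from_append del: upt_Suc)
qed

lemma count_list_sweep:
  "count_list (concat (map (\<lambda>x. x # t x) xs)) v
     = (\<Sum>x\<leftarrow>xs. of_bool (x = v) + count_list (t x) v)"
  by (induction xs) auto

text \<open>From \<open>x\<close>, \<open>q x L\<close> round trips are made over \<open>L\<close>
  edges. The strict inequality in \<open>room\<close> keeps one request to each vertex for the
  sweep, and \<open>support\<close> keeps the trips on vertices of \<open>J\<close>.\<close>

lemma reorder_walk:
  assumes walk: "successively adj J" "J \<noteq> []" and k: "1 \<le> k"
    and room: "\<And>v. v \<in> set J \<Longrightarrow>
      (\<Sum>(x, L)\<in>set J \<times> {k, Suc k}. q x L * count_list (loop x L) v) < count_list J v"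
    and support: "\<And>x L. x \<in> set J \<Longrightarrow> L \<in> {k, Suc k} \<Longrightarrow> 0 < q x L \<Longrightarrow> {x..x + L} \<subseteq> set J"
  shows "\<exists>J'. mset J' = mset J \<and> successively adj J' \<and>
    (\<Sum>(x, L)\<in>set J \<times> {k, Suc k}. q x L * (2 * (L + 1 - k))) \<le> LRU k J'"
proof -
  interpret demand_paging k "lru_step k" by (rule demand_paging_lru[OF k])
  obtain l r where lr: "l \<le> r" "set J = {l..r}"
    using walk_set[OF walk] by blast
  define U where "U v = (\<Sum>(x, L)\<in>set J \<times> {k, Suc k}. q x L * count_list (loop x L) v)" for v
  \<comment> \<open>The requests left over at \<open>x\<close> are repeated on the spot; the
    subtracted 1 is the visit of the sweep itself.\<close>
  define t where "t x = concat (replicate (q x k) (loop x k)) @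
    concat (replicate (q x (Suc k)) (loop x (Suc k))) @ replicate (count_list J x - U x - 1) x" for x
  define J' where "J' = concat (map (\<lambda>x. x # t x) [l..<Suc r])"
  have sums: "(\<Sum>(x, L)\<in>set J \<times> {k, Suc k}. g x L) = (\<Sum>x\<in>{l..r}. g x k + g x (Suc k))"
    for g :: "nat \<Rightarrow> nat \<Rightarrow> nat"
    by (simp add: lr(2) sum.cartesian_product[symmetric])
  have exc: "excursion x (t x)" for x
    unfolding t_def using k
    by (intro excursion_append excursion_concat_replicate excursion_loop excursion_replicate) auto
  have "count_list J' v = count_list J v" for v
  proof -
    have "count_list J' v = (\<Sum>x\<in>{l..r}. of_bool (x = v) + count_list (t x) v)"
      by (simp only: J'_def count_list_sweep interv_sum_list_conv_sum_set_nat set_upt atLeastLessThanSuc_atLeastAtMost)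
    also have "\<dots> = (\<Sum>x\<in>{l..r}. (q x k * count_list (loop x k) v + q x (Suc k) * count_list (loop x (Suc k)) v)
        + (if x = v then count_list J v - U v - 1 + 1 else 0))"
      by (intro sum.cong) (auto simp: t_def count_list_concat_replicate count_list_replicate)
    also have "\<dots> = U v + (if v \<in> set J then count_list J v - U v - 1 + 1 else 0)"
      unfolding U_def sums by (simp add: sum.distrib lr(2))
    also have "\<dots> = count_list J v"
    proof (cases "v \<in> set J")
      case True
      then show ?thesis
        using room[of v] by (simp add: U_def)
    next
      case False
      have "q x L * count_list (loop x L) v = 0" if "x \<in> set J" "L \<in> {k, Suc k}" for x L
      proof (cases "q x L = 0")
        case q: False
        then have "v \<notin> {x..x + L}"
          using support[OF that] False by blast
        then show ?thesis by (auto simp: count_list_loop)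
      qed simp
      then have "U v = 0"
        unfolding U_def by (intro sum.neutral) auto
      then show ?thesis
        using False by simp
    qed
    finally show ?thesis .
  qed
  then have "mset J' = mset J"
    by (intro multiset_eqI) (simp add: count_mset)
  moreover have "successively adj J'"
    using walk_sweep[OF exc lr(1)] by (simp add: J'_def)
  moreover have "(\<Sum>(x, L)\<in>set J \<times> {k, Suc k}. q x L * (2 * (L + 1 - k))) \<le> LRU k J'"
  proof -
    have loops: "n * (2 * (L + 1 - k)) \<le> faults_from (lru_step k) C (concat (replicate n (loop x L)))"
      if "1 \<le> L" "length C \<le> k" "x \<in> set C" for n L C x
      using that excursion_loop[of L x]
      by (intro faults_concat_replicate_ge[where x = x] faults_loop_ge demand_paging_lru k)
        (auto simp: excursion_def)
    have tail: "q x k * (2 * (k + 1 - k)) + q x (Suc k) * (2 * (Suc k + 1 - k)) \<le> faults_from (lru_step k) C (t x)"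
      if "length C \<le> k" "x \<in> set C" for C x
    proof -
      let ?w = "concat (replicate (q x k) (loop x k))"
      let ?C = "foldl (lru_step k) C ?w"
      have "last (x # ?w) = x"
        using excursion_concat_replicate[OF excursion_loop[OF k]] by (simp add: excursion_def)
      then have "x \<in> set ?C"
        using that last_mem_foldl[of ?w C] by (cases "?w = []") (auto simp del: concat_eq_Nil_conv)
      moreover have "length ?C \<le> k"
        using that by (simp add: length_foldl)
      ultimately show ?thesis
        using loops[of k C x "q x k"] loops[of "Suc k" ?C x "q x (Suc k)"] that k
        unfolding t_def faults_from_append by linarith
    qed
    have "(\<Sum>(x, L)\<in>set J \<times> {k, Suc k}. q x L * (2 * (L + 1 - k)))
      = (\<Sum>x\<leftarrow>[l..<Suc r]. q x k * (2 * (k + 1 - k)) + q x (Suc k) * (2 * (Suc k + 1 - k)))"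
      by (simp only: sums interv_sum_list_conv_sum_set_nat set_upt atLeastLessThanSuc_atLeastAtMost)
    also have "\<dots> \<le> LRU k J'"
      unfolding LRU_def J'_def by (rule faults_sweep_ge[OF tail]) simp_all
    finally show ?thesis .
  qed
  ultimately show ?thesis by blast
qed

text \<open>Halving turns \<open>2 * c\<close> into \<open>c\<close>; the further \<open>- 1\<close>
  makes the bound strict, since a summand with positive \<open>q\<close> and \<open>d\<close> leaves
  a gap of at least 2 before halving. If there is none, \<open>0 < c\<close> suffices.\<close>

lemma sum_mult_less_of_half_minus_one:
  fixes q h d :: "'b \<Rightarrow> nat"
  assumes "finite T" "\<And>z. z \<in> T \<Longrightarrow> q z = h z div 2 - 1"
    and "(\<Sum>z\<in>T. h z * d z) \<le> 2 * c" "0 < c"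
  shows "(\<Sum>z\<in>T. q z * d z) < c"
proof (cases "\<forall>z\<in>T. q z * d z = 0")
  case True
  then have "(\<Sum>z\<in>T. q z * d z) = 0"
    by (intro sum.neutral) auto
  then show ?thesis using assms(4) by simp
next
  case False
  then obtain y where y: "y \<in> T" "0 < q y" "0 < d y"
    by auto
  have "2 * (\<Sum>z\<in>T. q z * d z) + 2 = (\<Sum>z\<in>T. 2 * (q z * d z) + (if z = y then 2 else 0))"
    using assms(1) y(1) by (simp add: sum.distrib sum_distrib_left)
  also have "\<dots> \<le> (\<Sum>z\<in>T. h z * d z)"
  proof (rule sum_mono)
    fix z assume z: "z \<in> T"
    show "2 * (q z * d z) + (if z = y then 2 else 0) \<le> h z * d z"
    proof (cases "q z = 0")
      case True
      then show ?thesis using y(2) by auto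
    next
      case False
      then have "2 * q z + 2 \<le> h z"
        using assms(2)[OF z] by linarith
      then have "(2 * q z + 2) * d z \<le> h z * d z"
        by (rule mult_le_mono1)
      then have "2 * (q z * d z) + 2 * d z \<le> h z * d z"
        by (simp add: algebra_simps)
      moreover have "(if z = y then 2 else 0) \<le> 2 * d z"
        using y(3) by simp
      ultimately show ?thesis
        by linarith
    qed
  qed
  finally show ?thesis
    using assms(3) by linarith
qed

lemma sum_fiber_card:
  fixes g :: "'b \<Rightarrow> nat"
  assumes "finite S" "finite T" "\<phi> ` S \<subseteq> T"
  shows "(\<Sum>m\<in>S. g (\<phi> m)) = (\<Sum>z\<in>T. card {m \<in> S. \<phi> m = z} * g z)"
proof -
  have "(\<Sum>m\<in>S. g (\<phi> m)) = (\<Sum>z\<in>T. \<Sum>m\<in>{m \<in> S. \<phi> m = z}. g (\<phi> m))"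
    using assms by (intro sum.group[symmetric])
  also have "\<dots> = (\<Sum>z\<in>T. card {m \<in> S. \<phi> m = z} * g z)"
    by (intro sum.cong) auto
  finally show ?thesis .
qed

text \<open>Phases are grouped by their interval \<open>(x, L)\<close>. The crossings they guarantee
  are converted into round trips on that interval, and each of the at most \<open>2 * N\<close>
  intervals loses a bounded number of faults by rounding.\<close>

lemma FIFO_le_LRU_reordered:
  assumes k: "1 \<le> k" and walk: "successively adj J" and N: "set J \<subseteq> {..<N}"
  shows "\<exists>J'. mset J' = mset J \<and> successively adj J' \<and>
    2 * FIFO k J \<le> (k + 1) * (LRU k J' + 12 * N + 2)"
proof (cases "J = []")
  case True
  then show ?thesis by (intro exI[of _ J]) (simp add: FIFO_def)
next
  case nonempty: False
  obtain ts where ts: "sorted_wrt (<) ts" "\<And>t. t \<in> set ts \<Longrightarrow> t < length J" "length ts = FIFO k J"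
    "\<And>i j. i < j \<Longrightarrow> j < length ts \<Longrightarrow> j \<le> i + k \<Longrightarrow> J ! (ts ! i) \<noteq> J ! (ts ! j)"
    using fifo_fault_times[OF k, of J] by blast
  \<comment> \<open>Consecutive phases share a fault, so \<open>M\<close> phases use
    \<open>M * Suc k + 1\<close> faults; hence the \<open>- 1\<close>.\<close>
  define M where "M = (FIFO k J - 1) div Suc k"
  have index: "m * Suc k + i < length ts" if "m < M" "i \<le> Suc k" for m i
  proof -
    have "Suc m * Suc k \<le> M * Suc k"
      using that(1) by (intro mult_le_mono1) simp
    also have "\<dots> \<le> FIFO k J - 1"
      unfolding M_def by (rule div_times_less_eq_dividend)
    finally have "Suc m * Suc k \<le> FIFO k J - 1" .
    moreover have "0 < Suc m * Suc k" by simp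
    ultimately show ?thesis
      using that(2) ts(3) by simp
  qed
  define T where "T m = ts ! (m * Suc k)" for m
  have "\<exists>x L. L \<in> {k, Suc k} \<and> (\<forall>v. x \<le> v \<and> v < x + L \<longrightarrow>
      k + 2 - L \<le> card (crossings J v \<inter> {T m..<T (Suc m)}))" if m: "m < M" for m
  proof -
    let ?t = "\<lambda>i. ts ! (m * Suc k + i)"
    have T_eq: "T m = ?t 0" "T (Suc m) = ?t (Suc k)"
      by (simp_all add: T_def ac_simps)
    show ?thesis
      unfolding T_eq
    proof (rule phase_crossings[OF walk])
      show "?t i < ?t j" if "i < j" "j \<le> Suc k" for i j
        using ts(1) that index[OF m that(2)] by (intro sorted_wrt_nth_less) auto
      show "?t (Suc k) < length J"
        using index[OF m, of "Suc k"] by (intro ts(2) nth_mem) simp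
      show "J ! ?t i \<noteq> J ! ?t j" if "i < j" "j \<le> Suc k" "j \<le> i + k" for i j
        using index[OF m that(2)] that by (intro ts(4)) auto
    qed
  qed
  then obtain X L where L: "\<And>m. m < M \<Longrightarrow> L m \<in> {k, Suc k}"
    and cross: "\<And>m v. m < M \<Longrightarrow> X m \<le> v \<Longrightarrow> v < X m + L m \<Longrightarrow>
      k + 2 - L m \<le> card (crossings J v \<inter> {T m..<T (Suc m)})"
    by metis
  have covered: "{X m..X m + L m} \<subseteq> set J" if m: "m < M" for m
  proof
    fix v assume v: "v \<in> {X m..X m + L m}"
    have cr: "\<exists>t. t \<in> crossings J u" if "X m \<le> u" "u < X m + L m" for u
    proof -
      have "0 < card (crossings J u \<inter> {T m..<T (Suc m)})"
        using cross[OF m that] L[OF m] by auto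
      then show ?thesis
        by (metis Int_iff card_gt_0_iff ex_in_conv)
    qed
    show "v \<in> set J"
    proof (cases "v < X m + L m")
      case True
      then show ?thesis
        using cr[of v] v crossing_vertices by auto
    next
      case False
      then have "v = Suc (v - 1)" "X m \<le> v - 1" "v - 1 < X m + L m"
        using v L[OF m] k by auto
      then show ?thesis
        using cr[of "v - 1"] crossing_vertices(2) by metis
    qed
  qed
  let ?Z = "set J \<times> {k, Suc k}"
  define \<phi> where "\<phi> m = (X m, L m)" for m
  have \<phi>: "\<phi> ` {..<M} \<subseteq> ?Z"
  proof
    fix z assume "z \<in> \<phi> ` {..<M}"
    then obtain m where m: "m < M" "z = (X m, L m)"
      by (auto simp: \<phi>_def)
    have "X m \<in> {X m..X m + L m}"
      by simp
    then show "z \<in> ?Z"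
      using m covered[OF m(1)] L[OF m(1)] by blast
  qed
  \<comment> \<open>The crossings that the phases on \<open>z\<close> guarantee for each edge of
    \<open>z\<close>. A round trip uses an edge twice, hence the \<open>div 2\<close> in
    \<open>q\<close>; the \<open>- 1\<close> there creates the strict room for the sweep.\<close>
  define h where "h z = card {m \<in> {..<M}. \<phi> m = z} * (k + 2 - snd z)" for z
  define q where "q x L = h (x, L) div 2 - 1" for x L
  have weight: "(\<Sum>z\<in>?Z. h z * g z) = (\<Sum>m<M. (k + 2 - L m) * g (\<phi> m))" for g :: "nat \<times> nat \<Rightarrow> nat"
    using sum_fiber_card[OF _ _ \<phi>, of "\<lambda>z. (k + 2 - snd z) * g z"]
    by (simp add: h_def \<phi>_def mult.assoc)
  \<comment> \<open>Each phase counts \<open>v\<close> once per edge of its interval at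
    \<open>v\<close>, weighted by the guaranteed crossings. As phases have disjoint time intervals,
    these add up to at most the actual crossings, which the requests to \<open>v\<close>
    bound.\<close>
  have "(\<Sum>m<M. (k + 2 - L m) * count_list (loop (X m) (L m)) v) \<le> 2 * count_list J v" for v
  proof -
    have Tmono: "T m \<le> T (Suc m)" if "m < M" for m
      using sorted_wrt_nth_less[OF ts(1), of "m * Suc k" "Suc m * Suc k"] index[OF that, of "Suc k"]
      by (simp add: T_def ac_simps)
    have edge: "(\<Sum>m<M. (k + 2 - L m) * of_bool (X m \<le> u \<and> u < X m + L m)) \<le> card (crossings J u)" for u
    proof -
      have "(\<Sum>m<M. (k + 2 - L m) * of_bool (X m \<le> u \<and> u < X m + L m))
        \<le> (\<Sum>m<M. card (crossings J u \<inter> {T m..<T (Suc m)}))"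
        using cross[of _ u] by (intro sum_mono) auto
      also have "\<dots> \<le> card (crossings J u)"
        by (intro card_consecutive_intervals finite_crossings Tmono)
      finally show ?thesis .
    qed
    have "(\<Sum>m<M. (k + 2 - L m) * of_bool (X m < v \<and> v \<le> X m + L m))
      \<le> (if v = 0 then 0 else card (crossings J (v - 1)))"
    proof (cases v)
      case (Suc u)
      then show ?thesis
        using edge[of u] by (simp add: less_Suc_eq_le Suc_le_eq)
    qed simp
    then show ?thesis
      using edge[of v] card_crossings_le_count[of J v]
      by (simp add: count_list_loop distrib_left sum.distrib)
  qed
  then have load: "(\<Sum>z\<in>?Z. h z * count_list (loop (fst z) (snd z)) v) \<le> 2 * count_list J v" for v
    unfolding weight by (simp add: \<phi>_def)
  have room: "(\<Sum>(x, L)\<in>?Z. q x L * count_list (loop x L) v) < count_list J v" if "v \<in> set J" for v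
  proof -
    have "0 < count_list J v"
      using that by (metis count_list_0_iff gr0I)
    then show ?thesis
      using sum_mult_less_of_half_minus_one[OF _ _ load[of v], of "\<lambda>z. q (fst z) (snd z)"]
      by (simp add: q_def split_def)
  qed
  have support: "{x..x + L'} \<subseteq> set J" if "0 < q x L'" for x L'
  proof -
    have "0 < h (x, L')"
      using that unfolding q_def by (cases "h (x, L') = 0") auto
    then have "{m \<in> {..<M}. \<phi> m = (x, L')} \<noteq> {}"
      unfolding h_def by (metis card.empty less_irrefl mult_0)
    then obtain m where "m < M" "X m = x" "L m = L'"
      by (auto simp: \<phi>_def)
    then show ?thesis
      using covered by blast
  qed
  obtain J' where J': "mset J' = mset J" "successively adj J'"
    "(\<Sum>(x, L)\<in>?Z. q x L * (2 * (L + 1 - k))) \<le> LRU k J'"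
    using reorder_walk[OF walk nonempty k room support] by blast
  have "card ?Z \<le> 2 * N"
    using card_mono[OF _ N] by (simp add: card_cartesian_product)
  have "2 * M = (\<Sum>m<M. 2)"
    by simp
  also have "\<dots> = (\<Sum>z\<in>?Z. card {m \<in> {..<M}. \<phi> m = z} * 2)"
    using sum_fiber_card[OF _ _ \<phi>, of "\<lambda>_. 2"] by simp
  \<comment> \<open>The worst loss occurs for \<open>snd z = Suc k\<close> and an odd number
    \<open>n \<ge> 3\<close> of phases, where \<open>4 * (n div 2 - 1) = 2 * n - 6\<close>.\<close>
  also have "\<dots> \<le> (\<Sum>z\<in>?Z. q (fst z) (snd z) * (2 * (snd z + 1 - k)) + 6)"
  proof (rule sum_mono)
    fix z assume "z \<in> ?Z"
    define n where "n = card {m \<in> {..<M}. \<phi> m = z}"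
    have q_eq: "q (fst z) (snd z) = n * (k + 2 - snd z) div 2 - 1"
      by (simp add: q_def h_def n_def)
    from \<open>z \<in> ?Z\<close> consider "snd z = k" | "snd z = Suc k"
      by auto
    then show "card {m \<in> {..<M}. \<phi> m = z} * 2 \<le> q (fst z) (snd z) * (2 * (snd z + 1 - k)) + 6"
      unfolding n_def[symmetric] q_eq by cases auto
  qed
  also have "\<dots> = (\<Sum>(x, L)\<in>?Z. q x L * (2 * (L + 1 - k))) + 6 * card ?Z"
    by (simp add: sum.distrib split_def)
  also have "\<dots> \<le> LRU k J' + 12 * N"
    using J'(3) \<open>card ?Z \<le> 2 * N\<close> by linarith
  finally have M: "2 * M \<le> LRU k J' + 12 * N" .
  have "FIFO k J - 1 < Suc M * Suc k"
    unfolding M_def using dividend_less_div_times[of "Suc k" "FIFO k J - 1"] by simp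
  then have "FIFO k J \<le> Suc M * Suc k"
    by linarith
  then have "2 * FIFO k J \<le> Suc k * (2 * M + 2)"
    by (simp add: algebra_simps)
  also have "\<dots> \<le> Suc k * (LRU k J' + 12 * N + 2)"
    using M by (intro mult_le_mono2) simp
  finally show ?thesis
    using J' by (intro exI[of _ J']) simp
qed

subsection \<open>FIFO on the zigzag\<close>

lemma fifo_hits:
  assumes "set w \<subseteq> set C"
  shows "foldl (fifo_step k) C w = C"
  using assms by (induction w) (auto simp: fifo_step_def)

lemma fifo_fill:
  assumes "j < k"
  shows "foldl (fifo_step k) (rev [0..<Suc j]) [Suc j..<Suc k] = rev [Suc 0..<Suc k]"
  using assms
proof (induction "k - j" arbitrary: j)
  case (Suc d)
  have step: "fifo_step k (rev [0..<Suc j]) (Suc j)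
      = (if Suc j < k then rev [0..<Suc (Suc j)] else rev [Suc 0..<Suc k])"
  proof (cases "Suc j < k")
    case False
    then have "k = Suc j"
      using Suc.prems by simp
    moreover have "rev [0..<Suc j] = rev [Suc 0..<Suc j] @ [0]"
      by (simp add: upt_conv_Cons del: upt_Suc)
    ultimately show ?thesis
      by (simp add: fifo_step_def bring_in_def butlast_append)
  qed (simp add: fifo_step_def bring_in_def)
  have "[Suc j..<Suc k] = Suc j # [Suc (Suc j)..<Suc k]"
    using Suc.prems by (simp add: upt_conv_Cons del: upt_Suc)
  then show ?case
    using step Suc.hyps(1)[of "Suc j"] Suc.hyps(2) Suc.prems
    by (cases "Suc j < k") (auto simp del: upt_Suc simp: less_antisym)
qed simp

text \<open>The list \<open>hole_state k j\<close> is the FIFO cache when the pages \<open>0, \<dots>, k\<close> are always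
  brought in in cyclic order, \<open>j\<close> came last and \<open>j + 1\<close> is missing.\<close>

definition hole_state :: "nat \<Rightarrow> nat \<Rightarrow> nat list" where
  "hole_state k j = rev [0..<Suc j] @ rev [Suc (Suc j)..<Suc k]"

text \<open>As long as \<open>j + 1 < k\<close>, the fault on \<open>j + 1\<close> evicts
  \<open>j + 2\<close>, the page requested next on the way up; at the top it evicts 0.\<close>

lemma hole_state_step:
  assumes "j < k"
  shows "Suc j \<notin> set (hole_state k j)"
    and "fifo_step k (hole_state k j) (Suc j) = (if Suc j < k then hole_state k (Suc j) else rev [Suc 0..<Suc k])"
proof -
  show notin: "Suc j \<notin> set (hole_state k j)"
    by (auto simp: hole_state_def simp del: upt_Suc)
  have len: "length (hole_state k j) = k"
    using assms by (simp add: hole_state_def del: upt_Suc)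
  show "fifo_step k (hole_state k j) (Suc j) = (if Suc j < k then hole_state k (Suc j) else rev [Suc 0..<Suc k])"
  proof (cases "Suc j < k")
    case True
    have "[Suc (Suc j)..<Suc k] = Suc (Suc j) # [Suc (Suc (Suc j))..<Suc k]"
      using True by (simp add: upt_conv_Cons del: upt_Suc)
    then have "butlast (hole_state k j) = rev [0..<Suc j] @ rev [Suc (Suc (Suc j))..<Suc k]"
      by (simp add: hole_state_def butlast_append del: upt_Suc)
    then show ?thesis
      using True notin len by (simp add: fifo_step_def bring_in_def hole_state_def)
  next
    case False
    then have k: "k = Suc j"
      using assms by simp
    have "rev [0..<Suc j] = rev [Suc 0..<Suc j] @ [0]"
      by (simp add: upt_conv_Cons del: upt_Suc)
    then have "butlast (hole_state k j) = rev [Suc 0..<Suc j]"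
      by (simp add: hole_state_def k butlast_append)
    then show ?thesis
      using False notin len by (simp add: fifo_step_def bring_in_def k)
  qed
qed

lemma hole_state_up:
  assumes "j < k"
  shows "faults_from (fifo_step k) (hole_state k j) [Suc j..<Suc k] = k - j"
    and "foldl (fifo_step k) (hole_state k j) [Suc j..<Suc k] = rev [Suc 0..<Suc k]"
proof -
  have "faults_from (fifo_step k) (hole_state k j) [Suc j..<Suc k] = k - j \<and>
    foldl (fifo_step k) (hole_state k j) [Suc j..<Suc k] = rev [Suc 0..<Suc k]"
    using assms
  proof (induction "k - j" arbitrary: j)
    case (Suc d)
    have cons: "[Suc j..<Suc k] = Suc j # [Suc (Suc j)..<Suc k]"
      using Suc.prems by (simp add: upt_conv_Cons del: upt_Suc)
    show ?case
    proof (cases "Suc j < k")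
      case True
      then show ?thesis
        using Suc.hyps(1)[of "Suc j"] Suc.hyps(2) hole_state_step[OF Suc.prems]
        by (simp add: cons del: upt_Suc)
    next
      case False
      then have "k - j = 1" "[Suc (Suc j)..<Suc k] = []"
        using Suc.prems by simp_all
      then show ?thesis
        using hole_state_step[OF Suc.prems] False by (simp add: cons del: upt_Suc)
    qed
  qed simp
  then show "faults_from (fifo_step k) (hole_state k j) [Suc j..<Suc k] = k - j"
    "foldl (fifo_step k) (hole_state k j) [Suc j..<Suc k] = rev [Suc 0..<Suc k]"
    by simp_all
qed

text \<open>After the way up the one missing page is 0, so the way down hits until it gets there.
  The fault on 0 evicts 1 and restores \<open>hole_state k 0\<close>.\<close>

lemma hole_state_down:
  assumes "1 \<le> k"
  shows "faults_from (fifo_step k) (rev [Suc 0..<Suc k]) (rev [0..<k]) \<ge> 1"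
    and "foldl (fifo_step k) (rev [Suc 0..<Suc k]) (rev [0..<k]) = hole_state k 0"
proof -
  let ?C = "rev [Suc 0..<Suc k]"
  have w: "rev [0..<k] = rev [Suc 0..<k] @ [0]"
    using assms by (simp add: upt_conv_Cons)
  have hits: "foldl (fifo_step k) ?C (rev [Suc 0..<k]) = ?C"
    by (intro fifo_hits) auto
  show "faults_from (fifo_step k) ?C (rev [0..<k]) \<ge> 1"
    by (simp add: w faults_from_append hits del: upt_Suc)
  have "?C = rev [Suc (Suc 0)..<Suc k] @ [Suc 0]"
    using assms by (simp add: upt_conv_Cons del: upt_Suc)
  then have "butlast ?C = rev [Suc (Suc 0)..<Suc k]"
    by (metis butlast_snoc)
  then have "fifo_step k ?C 0 = hole_state k 0"
    by (simp add: fifo_step_def bring_in_def hole_state_def del: upt_Suc) simp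
  then show "foldl (fifo_step k) ?C (rev [0..<k]) = hole_state k 0"
    by (simp add: w hits del: upt_Suc)
qed

text \<open>A round trip from \<open>hole_state k 0\<close> faults \<open>k\<close> times going up
  and once more at 0. The extra round trip at the start leads into this periodic state; its faults
  are dropped.\<close>

lemma FIFO_zigzag:
  assumes "1 \<le> k"
  shows "(k + 1) * n \<le> FIFO k (0 # concat (replicate (Suc n) (loop 0 k)))"
proof -
  have start: "fifo_step k [] 0 = rev [0..<Suc 0]"
    using assms by (simp add: fifo_step_def bring_in_def)
  have "foldl (fifo_step k) (rev [0..<Suc 0]) (loop 0 k) = hole_state k 0"
    using fifo_fill[of 0 k] hole_state_down[OF assms] assms by (simp add: loop_def del: upt_Suc)
  moreover have "(k + 1) * n \<le> faults_from (fifo_step k) (hole_state k 0) (concat (replicate n (loop 0 k)))"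
  proof (induction n)
    case (Suc n)
    have "foldl (fifo_step k) (hole_state k 0) (loop 0 k) = hole_state k 0"
      using hole_state_up[of 0 k] hole_state_down[OF assms] assms by (simp add: loop_def del: upt_Suc)
    moreover have "k + 1 \<le> faults_from (fifo_step k) (hole_state k 0) (loop 0 k)"
      using hole_state_up[of 0 k] hole_state_down[OF assms] assms
      by (simp add: loop_def faults_from_append del: upt_Suc)
    ultimately show ?case
      using Suc by (simp add: faults_from_append)
  qed simp
  ultimately show ?thesis
    by (simp add: FIFO_def start faults_from_append del: upt_Suc)
qed

subsection \<open>The ratio\<close>

lemma FIFO_worst_ge_LRU_worst:
  assumes "1 \<le> k" "respects_graph (path_graph N) I"
  shows "worst_order (path_graph N) (LRU k) I \<le> worst_order (path_graph N) (FIFO k) I + k"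
proof -
  obtain J where J: "mset J = mset I" "respects_graph (path_graph N) J"
    "worst_order (path_graph N) (LRU k) I = LRU k J"
    using worst_order_attained[OF assms(2)] .
  have "LRU k J \<le> FIFO k J + k"
    using LRU_le_FIFO[OF assms(1)] J(2) by (simp add: respects_path_graph_iff)
  then show ?thesis
    using worst_order_ge[OF J(1,2), of "FIFO k"] J(3) by linarith
qed

lemma FIFO_worst_le_LRU_worst:
  assumes "1 \<le> k" "respects_graph (path_graph N) I"
  shows "2 * worst_order (path_graph N) (FIFO k) I
    \<le> (k + 1) * (worst_order (path_graph N) (LRU k) I + 12 * N + 2)"
proof -
  obtain J where J: "mset J = mset I" "respects_graph (path_graph N) J"
    "worst_order (path_graph N) (FIFO k) I = FIFO k J"
    using worst_order_attained[OF assms(2)] .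
  have walk: "successively adj J" "set J \<subseteq> {..<N}"
    using J(2) by (auto simp: respects_path_graph_iff)
  obtain J' where J': "mset J' = mset J" "successively adj J'"
    "2 * FIFO k J \<le> (k + 1) * (LRU k J' + 12 * N + 2)"
    using FIFO_le_LRU_reordered[OF assms(1) walk] by blast
  have "respects_graph (path_graph N) J'"
    using J'(2) walk(2) mset_eq_setD[OF J'(1)] by (simp add: respects_path_graph_iff)
  then have "LRU k J' \<le> worst_order (path_graph N) (LRU k) I"
    using J(1) J'(1) by (intro worst_order_ge) simp_all
  then have "(k + 1) * (LRU k J' + 12 * N + 2) \<le> (k + 1) * (worst_order (path_graph N) (LRU k) I + 12 * N + 2)"
    by (intro mult_le_mono2) simp
  then show ?thesis
    using J(3) J'(3) by linarith
qed

text \<open>\<open>LRU_le_ends\<close> bounds LRU by the numbers of requests to the two ends, which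
  no reordering changes, so the bound covers the worst order as well.\<close>

lemma zigzag_family:
  assumes "1 \<le> k" "k + 1 \<le> N"
  obtains I where "respects_graph (path_graph N) I"
    "(k + 1) * n \<le> worst_order (path_graph N) (FIFO k) I"
    "worst_order (path_graph N) (LRU k) I \<le> 2 * n + k + 3"
proof -
  define I where "I = 0 # concat (replicate (Suc n) (loop 0 k))"
  have "excursion 0 (concat (replicate (Suc n) (loop 0 k)))"
    by (intro excursion_concat_replicate excursion_loop assms)
  then have walk: "successively adj I"
    by (simp add: I_def excursion_def)
  have range: "set I \<subseteq> {..k}"
    by (auto simp: I_def loop_def)
  have I: "respects_graph (path_graph N) I"
    using walk range assms(2) by (auto simp: respects_path_graph_iff)
  have "(k + 1) * n \<le> worst_order (path_graph N) (FIFO k) I"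
    using FIFO_zigzag[OF assms(1), of n] worst_order_ge[OF refl I, of "FIFO k"]
    unfolding I_def by linarith
  moreover have "worst_order (path_graph N) (LRU k) I \<le> 2 * n + k + 3"
  proof -
    obtain J where J: "mset J = mset I" "respects_graph (path_graph N) J"
      "worst_order (path_graph N) (LRU k) I = LRU k J"
      using worst_order_attained[OF I] .
    have count_eq: "count_list J v = count_list I v" for v
      using J(1) by (metis count_mset)
    have "LRU k J \<le> k + (count_list J 0 + count_list J k)"
      using J(2) range mset_eq_setD[OF J(1)]
      by (intro LRU_le_ends assms) (simp_all add: respects_path_graph_iff)
    \<comment> \<open>Page 0 is requested \<open>n + 2\<close> times, counting the initial request,
      and page \<open>k\<close> is requested \<open>n + 1\<close> times.\<close>
    also have "\<dots> = 2 * n + k + 3"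
      using assms(1) by (simp add: count_eq I_def count_list_concat_replicate count_list_loop del: replicate_Suc)
    finally show ?thesis
      using J(3) by simp
  qed
  ultimately show thesis
    using that I by blast
qed

theorem theorem5:
  fixes k N :: nat
  assumes "k \<ge> 1" and "N \<ge> k + 1"
  shows "WR (path_graph N) (FIFO k) (LRU k) = Some (ereal ((real k + 1) / 2))"
proof -
  let ?G = "path_graph N"
  let ?F = "worst_order ?G (FIFO k)" and ?L = "worst_order ?G (LRU k)"
  have "real (?F I) \<ge> 1 * real (?L I) - real k" if "respects_graph ?G I" for I
    using FIFO_worst_ge_LRU_worst[OF assms(1) that] by linarith
  then have "ereal 1 \<le> c_l ?G (FIFO k) (LRU k)"
    unfolding c_l_def by (intro Sup_upper) blast
  then have lower: "1 \<le> c_l ?G (FIFO k) (LRU k)"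
    by (simp add: one_ereal_def)
  have "real (?F I) \<le> (real k + 1) / 2 * real (?L I) + (real k + 1) * (6 * real N + 1)"
    if "respects_graph ?G I" for I
  proof -
    have "real (2 * ?F I) \<le> real ((k + 1) * (?L I + 12 * N + 2))"
      using FIFO_worst_le_LRU_worst[OF assms(1) that] of_nat_mono by blast
    then show ?thesis
      by (simp add: field_simps)
  qed
  then have "c_u ?G (FIFO k) (LRU k) \<le> ereal ((real k + 1) / 2)"
    unfolding c_u_def by (intro Inf_lower) blast
  moreover have "ereal ((real k + 1) / 2) \<le> c_u ?G (FIFO k) (LRU k)"
    unfolding c_u_def
  proof (rule Inf_greatest)
    fix x assume "x \<in> {ereal c | c. \<exists>b::real. \<forall>I. respects_graph ?G I \<longrightarrow> real (?F I) \<le> c * real (?L I) + b}"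
    then obtain c b where x: "x = ereal c"
      and bound: "\<And>I. respects_graph ?G I \<Longrightarrow> real (?F I) \<le> c * real (?L I) + b"
      by blast
    show "ereal ((real k + 1) / 2) \<le> x"
    proof (rule ccontr)
      assume less: "\<not> ereal ((real k + 1) / 2) \<le> x"
      \<comment> \<open>A negative \<open>c\<close> could not be multiplied with an upper bound on
        the cost of LRU.\<close>
      define d where "d = max c 0"
      have d: "c \<le> d" "0 \<le> d" "0 < real k + 1 - 2 * d"
        using less x by (auto simp: d_def field_simps max_def)
      have "(real k + 1 - 2 * d) * real n \<le> d * (real k + 3) + b" for n
      proof -
        obtain I where I: "respects_graph ?G I" "(k + 1) * n \<le> ?F I" "?L I \<le> 2 * n + k + 3"
          using zigzag_family[OF assms] .
        have "real ((k + 1) * n) \<le> real (?F I)"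
          using I(2) of_nat_mono by blast
        also have "\<dots> \<le> c * real (?L I) + b"
          using bound I(1) by blast
        also have "\<dots> \<le> d * real (2 * n + k + 3) + b"
          using d I(3) by (intro add_right_mono mult_mono) (simp_all only: of_nat_le_iff of_nat_0_le_iff)
        finally show ?thesis
          by (simp add: algebra_simps)
      qed
      moreover obtain n :: nat where "d * (real k + 3) + b < real n * (real k + 1 - 2 * d)"
        using ex_less_of_nat_mult[OF d(3)] by blast
      ultimately show False
        by (metis mult.commute not_le)
    qed
  qed
  ultimately show ?thesis
    using lower unfolding WR_def by simp
qed

end
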